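(* Let $(S,\lhd)$ be a shelf, $\Lambda=\mathbb Z[T^{\pm1}]$, and let $\Lambda S$ be the free $\Lambda$-module on $S$. The pre-braiding $\sigma_\lhd$ on $\Lambda S$ combined with the braided characters $\varepsilon$ and $\epsilon_T$ (the $\Lambda$-linear maps $\Lambda S\to\Lambda$ with $\varepsilon(a)=1$, $\epsilon_T(a)=T$ for all $a\in S$) define, as the pair $({}^{\varepsilon}d,d^{\epsilon_T})$ of braided differentials, a bicomplex structure on $T(\Lambda S)$ given by $${}^{\varepsilon}d(a_1,\ldots,a_n)=\sum_{i=1}^n(-1)^{i-1}(a_1\lhd a_i,\ldots,a_{i-1}\lhd a_i,a_{i+1},\ldots,a_n),$$ $$d^{\epsilon_T}(a_1,\ldots,a_n)=\sum_{i=1}^n(-1)^{i-1}\,T\,(a_1,\ldots,\widehat{a_i},\ldots,a_n),$$ and this bicomplex structure is refined to a pre-bisimplicial structure with face maps $d_{n;i}=\varepsilon_1\circ(\sigma_\lhd)_1\circ\cdots\circ(\sigma_\lhd)_{i-1}$ and $d'_{n;i}=(\epsilon_T)_n\circ(\sigma_\lhd)_{n-1}\circ\cdots\circ(\sigma_\lhd)_i$.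
   Context: A shelf is a set $S$ with a binary operation $\lhd$ such that $(a\lhd b)\lhd c=(a\lhd c)\lhd(b\lhd c)$ for all $a,b,c$. $\sigma_\lhd$ is the $\Lambda$-linear extension of $(a,b)\mapsto(b,a\lhd b)$ to $\Lambda S\otimes\Lambda S$. All tensor products are over $\Lambda$; $T(\Lambda S)=\bigoplus_{n\ge0}(\Lambda S)^{\otimes n}$, and $(\Lambda S)^{\otimes n}$ has $\Lambda$-basis $S^{\times n}$, its elements written $(a_1,\ldots,a_n)$. For a linear map $\varphi:V^{\otimes l}\to V^{\otimes r}$, $\varphi_i=\mathrm{Id}_{V^{\otimes(i-1)}}\otimes\varphi\otimes\mathrm{Id}$. A pre-braiding on $V$ is a linear $\sigma:V\otimes V\to V\otimes V$ with $\sigma_1\sigma_2\sigma_1=\sigma_2\sigma_1\sigma_2$. A braided character is a linear form $\epsilon$ on $V$ with $(\epsilon\otimes\epsilon)\circ\sigma=\epsilon\otimes\epsilon$. The braided differentials on $V^{\otimes n}$, $n\ge1$, attached to $\epsilon$ are ${}^{\epsilon}d=\sum_{i=1}^n(-1)^{i-1}\epsilon_1\circ\sigma_1\circ\cdots\circ\sigma_{i-1}$ and $d^{\epsilon}=\sum_{i=1}^n(-1)^{i-1}\epsilon_n\circ\sigma_{n-1}\circ\cdots\circ\sigma_i$ (and $0$ for $n=0$). A bicomplex is a graded module with two anticommuting square-zero maps of degree $-1$. A pre-bisimplicial structure on modules $(V_n)_{n\ge0}$: maps $d_{n;i},d'_{n;i}:V_n\to V_{n-1}$, $1\le i\le n$,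 such that for $1\le i<j\le n$ (first subscripts omitted, source $V_n$) $d_id_j=d_{j-1}d_i$, $d'_id'_j=d'_{j-1}d'_i$, $d_id'_j=d'_{j-1}d_i$, $d'_id_j=d_{j-1}d'_i$. *)

theory Defs
  imports Complex_Main "HOL-Library.Poly_Mapping"
begin

text \<open>The Laurent polynomial ring over the integers is the group ring of the additive group of
  integers; multiplication on \<^typ>\<open>int \<Rightarrow>\<^sub>0 int\<close> is convolution.\<close>

type_synonym laurent = "int \<Rightarrow>\<^sub>0 int"

definition laurent_T :: laurent where
  "laurent_T = Poly_Mapping.single 1 1"

definition shelf :: "'a set \<Rightarrow> ('a \<Rightarrow> 'a \<Rightarrow> 'a) \<Rightarrow> bool" where
  "shelf S op \<longleftrightarrow>
     (\<forall>a\<in>S. \<forall>b\<in>S. op a b \<in> S) \<and>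
     (\<forall>a\<in>S. \<forall>b\<in>S. \<forall>c\<in>S. op (op a b) c = op (op a c) (op b c))"

text \<open>Let V be the free module over a commutative ring with basis S. Its n-th tensor power is free
  on the n-tuples over S; it is realised inside the free module on all lists. In particular V is
  the power with n = 1, the ground ring is the power with n = 0 (basis the empty list), and a
  linear form on V is a map from power 1 to power 0. Maps are total functions on
  \<^typ>\<open>'a list \<Rightarrow>\<^sub>0 'r\<close>; only their values on the relevant tensor power matter.\<close>

type_synonym ('a, 'r) tensors = "'a list \<Rightarrow>\<^sub>0 'r"

definition tensor_power :: "'a set \<Rightarrow> nat \<Rightarrow> ('a, 'r::comm_ring_1) tensors set" where
  "tensor_power S n = {x. \<forall>w\<in>Poly_Mapping.keys x. length w = n \<and> set w \<subseteq> S}"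

definition basis :: "'b \<Rightarrow> ('b \<Rightarrow>\<^sub>0 'r::comm_ring_1)" where
  "basis w = Poly_Mapping.single w 1"

definition smult :: "'r::comm_ring_1 \<Rightarrow> ('b \<Rightarrow>\<^sub>0 'r) \<Rightarrow> ('b \<Rightarrow>\<^sub>0 'r)" where
  "smult c x = Poly_Mapping.map (\<lambda>r. c * r) x"

definition lin_ext :: "('b \<Rightarrow> ('c \<Rightarrow>\<^sub>0 'r)) \<Rightarrow> ('b \<Rightarrow>\<^sub>0 'r::comm_ring_1) \<Rightarrow> ('c \<Rightarrow>\<^sub>0 'r)" where
  "lin_ext f x = (\<Sum>w\<in>Poly_Mapping.keys x. smult (Poly_Mapping.lookup x w) (f w))"

definition tensor :: "('a, 'r::comm_ring_1) tensors \<Rightarrow> ('a, 'r) tensors \<Rightarrow> ('a, 'r) tensors" where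
  "tensor x y = lin_ext (\<lambda>u. lin_ext (\<lambda>v. basis (u @ v)) y) x"

text \<open>The tensor product of maps, the first of which has source the l-th tensor power.\<close>

definition tensor_map ::
  "nat \<Rightarrow> (('a, 'r::comm_ring_1) tensors \<Rightarrow> ('a, 'r) tensors)
       \<Rightarrow> (('a, 'r) tensors \<Rightarrow> ('a, 'r) tensors) \<Rightarrow> ('a, 'r) tensors \<Rightarrow> ('a, 'r) tensors" where
  "tensor_map l \<phi> \<psi> =
     lin_ext (\<lambda>w. tensor (\<phi> (basis (take l w))) (\<psi> (basis (drop l w))))"

text \<open>\<open>at_pos l \<phi> i\<close> is \<open>\<phi>\<^sub>i = Id \<otimes> \<phi> \<otimes> Id\<close>, with i - 1 identity factors
  on the left, for \<open>\<phi>\<close> with source the l-th tensor power. Applied to a list of length n, the right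
  identity acts on the remaining n - (i - 1) - l factors, so n need not be given.\<close>

definition at_pos ::
  "nat \<Rightarrow> (('a, 'r::comm_ring_1) tensors \<Rightarrow> ('a, 'r) tensors) \<Rightarrow> nat
       \<Rightarrow> ('a, 'r) tensors \<Rightarrow> ('a, 'r) tensors" where
  "at_pos l \<phi> i = tensor_map (i - 1) id (tensor_map l \<phi> id)"

definition linear_map_on ::
  "('r::comm_ring_1 \<Rightarrow> 'm::ab_group_add \<Rightarrow> 'm) \<Rightarrow> 'm set \<Rightarrow> 'm set \<Rightarrow> ('m \<Rightarrow> 'm) \<Rightarrow> bool" where
  "linear_map_on scale U W f \<longleftrightarrow>
     (\<forall>x\<in>U. f x \<in> W) \<and>
     (\<forall>x\<in>U. \<forall>y\<in>U. f (x + y) = f x + f y) \<and>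
     (\<forall>c. \<forall>x\<in>U. f (scale c x) = scale c (f x))"

definition pre_braiding ::
  "'a set \<Rightarrow> (('a, 'r::comm_ring_1) tensors \<Rightarrow> ('a, 'r) tensors) \<Rightarrow> bool" where
  "pre_braiding S \<sigma> \<longleftrightarrow>
     linear_map_on smult (tensor_power S 2) (tensor_power S 2) \<sigma> \<and>
     (\<forall>x\<in>tensor_power S 3.
        (at_pos 2 \<sigma> 1 \<circ> at_pos 2 \<sigma> 2 \<circ> at_pos 2 \<sigma> 1) x =
        (at_pos 2 \<sigma> 2 \<circ> at_pos 2 \<sigma> 1 \<circ> at_pos 2 \<sigma> 2) x)"

definition braided_character ::
  "'a set \<Rightarrow> (('a, 'r::comm_ring_1) tensors \<Rightarrow> ('a, 'r) tensors)
       \<Rightarrow> (('a, 'r) tensors \<Rightarrow> ('a, 'r) tensors) \<Rightarrow> bool" where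
  "braided_character S \<sigma> \<epsilon> \<longleftrightarrow>
     linear_map_on smult (tensor_power S 1) (tensor_power S 0) \<epsilon> \<and>
     (\<forall>x\<in>tensor_power S 2. (tensor_map 1 \<epsilon> \<epsilon> \<circ> \<sigma>) x = tensor_map 1 \<epsilon> \<epsilon> x)"

definition comp_list :: "('b \<Rightarrow> 'b) list \<Rightarrow> 'b \<Rightarrow> 'b" where
  "comp_list fs = foldr (\<circ>) fs id"

text \<open>\<open>\<epsilon>\<^sub>1 \<circ> \<sigma>\<^sub>1 \<circ> \<dots> \<circ> \<sigma>\<^sub>i\<^sub>-\<^sub>1\<close> and
  \<open>\<epsilon>\<^sub>n \<circ> \<sigma>\<^sub>n\<^sub>-\<^sub>1 \<circ> \<dots> \<circ> \<sigma>\<^sub>i\<close> on the n-th tensor power.\<close>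

definition left_face ::
  "(('a, 'r::comm_ring_1) tensors \<Rightarrow> ('a, 'r) tensors)
     \<Rightarrow> (('a, 'r) tensors \<Rightarrow> ('a, 'r) tensors)
     \<Rightarrow> nat \<Rightarrow> nat \<Rightarrow> ('a, 'r) tensors \<Rightarrow> ('a, 'r) tensors" where
  "left_face \<sigma> \<epsilon> n i = at_pos 1 \<epsilon> 1 \<circ> comp_list (map (at_pos 2 \<sigma>) [1..<i])"

definition right_face ::
  "(('a, 'r::comm_ring_1) tensors \<Rightarrow> ('a, 'r) tensors)
     \<Rightarrow> (('a, 'r) tensors \<Rightarrow> ('a, 'r) tensors)
     \<Rightarrow> nat \<Rightarrow> nat \<Rightarrow> ('a, 'r) tensors \<Rightarrow> ('a, 'r) tensors" where
  "right_face \<sigma> \<epsilon> n i = at_pos 1 \<epsilon> n \<circ> comp_list (map (at_pos 2 \<sigma>) (rev [i..<n]))"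

definition left_differential ::
  "(('a, 'r::comm_ring_1) tensors \<Rightarrow> ('a, 'r) tensors)
     \<Rightarrow> (('a, 'r) tensors \<Rightarrow> ('a, 'r) tensors)
     \<Rightarrow> nat \<Rightarrow> ('a, 'r) tensors \<Rightarrow> ('a, 'r) tensors" where
  "left_differential \<sigma> \<epsilon> n x = (\<Sum>i=1..n. smult ((-1) ^ (i - 1)) (left_face \<sigma> \<epsilon> n i x))"

definition right_differential ::
  "(('a, 'r::comm_ring_1) tensors \<Rightarrow> ('a, 'r) tensors)
     \<Rightarrow> (('a, 'r) tensors \<Rightarrow> ('a, 'r) tensors)
     \<Rightarrow> nat \<Rightarrow> ('a, 'r) tensors \<Rightarrow> ('a, 'r) tensors" where
  "right_differential \<sigma> \<epsilon> n x = (\<Sum>i=1..n. smult ((-1) ^ (i - 1)) (right_face \<sigma> \<epsilon> n i x))"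

text \<open>A graded module is given by its homogeneous components V n, and a map of degree -1 by its
  restrictions d n from V n to V (n - 1). The component of degree -1 is zero, so d 0 has to vanish;
  as subtraction on naturals truncates, this is required separately.\<close>

definition bicomplex ::
  "('r::comm_ring_1 \<Rightarrow> 'm::ab_group_add \<Rightarrow> 'm) \<Rightarrow> (nat \<Rightarrow> 'm set)
     \<Rightarrow> (nat \<Rightarrow> 'm \<Rightarrow> 'm) \<Rightarrow> (nat \<Rightarrow> 'm \<Rightarrow> 'm) \<Rightarrow> bool" where
  "bicomplex scale V d d' \<longleftrightarrow>
     module scale \<and> (\<forall>n. module.subspace scale (V n)) \<and>
     (\<forall>n. linear_map_on scale (V n) (V (n - 1)) (d n)) \<and>
     (\<forall>n. linear_map_on scale (V n) (V (n - 1)) (d' n)) \<and>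
     (\<forall>x\<in>V 0. d 0 x = 0 \<and> d' 0 x = 0) \<and>
     (\<forall>n. \<forall>x\<in>V n. d (n - 1) (d n x) = 0) \<and>
     (\<forall>n. \<forall>x\<in>V n. d' (n - 1) (d' n x) = 0) \<and>
     (\<forall>n. \<forall>x\<in>V n. d (n - 1) (d' n x) = - d' (n - 1) (d n x))"

definition pre_bisimplicial ::
  "('r::comm_ring_1 \<Rightarrow> 'm::ab_group_add \<Rightarrow> 'm) \<Rightarrow> (nat \<Rightarrow> 'm set)
     \<Rightarrow> (nat \<Rightarrow> nat \<Rightarrow> 'm \<Rightarrow> 'm) \<Rightarrow> (nat \<Rightarrow> nat \<Rightarrow> 'm \<Rightarrow> 'm) \<Rightarrow> bool" where
  "pre_bisimplicial scale V f f' \<longleftrightarrow>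
     module scale \<and> (\<forall>n. module.subspace scale (V n)) \<and>
     (\<forall>n i. 1 \<le> i \<and> i \<le> n \<longrightarrow>
        linear_map_on scale (V n) (V (n - 1)) (f n i) \<and>
        linear_map_on scale (V n) (V (n - 1)) (f' n i)) \<and>
     (\<forall>n i j. 1 \<le> i \<and> i < j \<and> j \<le> n \<longrightarrow> (\<forall>x\<in>V n.
        f (n - 1) i (f n j x) = f (n - 1) (j - 1) (f n i x) \<and>
        f' (n - 1) i (f' n j x) = f' (n - 1) (j - 1) (f' n i x) \<and>
        f (n - 1) i (f' n j x) = f' (n - 1) (j - 1) (f n i x) \<and>
        f' (n - 1) i (f n j x) = f (n - 1) (j - 1) (f' n i x)))"

definition refined_by ::
  "('r::comm_ring_1 \<Rightarrow> 'm::ab_group_add \<Rightarrow> 'm) \<Rightarrow> (nat \<Rightarrow> 'm set)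
     \<Rightarrow> (nat \<Rightarrow> 'm \<Rightarrow> 'm) \<Rightarrow> (nat \<Rightarrow> 'm \<Rightarrow> 'm)
     \<Rightarrow> (nat \<Rightarrow> nat \<Rightarrow> 'm \<Rightarrow> 'm) \<Rightarrow> (nat \<Rightarrow> nat \<Rightarrow> 'm \<Rightarrow> 'm) \<Rightarrow> bool" where
  "refined_by scale V d d' f f' \<longleftrightarrow>
     pre_bisimplicial scale V f f' \<and>
     (\<forall>n. \<forall>x\<in>V n.
        d n x = (\<Sum>i=1..n. scale ((-1) ^ (i - 1)) (f n i x)) \<and>
        d' n x = (\<Sum>i=1..n. scale ((-1) ^ (i - 1)) (f' n i x)))"

text \<open>The linear extensions of \<open>(a, b) \<mapsto> (b, a \<lhd> b)\<close> and of \<open>a \<mapsto> c\<close>; the value 0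
  on lists of the wrong length is irrelevant.\<close>

definition shelf_braiding ::
  "('a \<Rightarrow> 'a \<Rightarrow> 'a) \<Rightarrow> ('a, 'r::comm_ring_1) tensors \<Rightarrow> ('a, 'r) tensors" where
  "shelf_braiding op = lin_ext (\<lambda>w. case w of [a, b] \<Rightarrow> basis [b, op a b] | _ \<Rightarrow> 0)"

definition const_form :: "'r::comm_ring_1 \<Rightarrow> ('a, 'r) tensors \<Rightarrow> ('a, 'r) tensors" where
  "const_form c = lin_ext (\<lambda>w. case w of [a] \<Rightarrow> smult c (basis []) | _ \<Rightarrow> 0)"

end

theory Submission
  imports Defs
begin

text \<open>
Every map in sight is linear, so it is enough to know the face maps on basis words, and there they
can be read as a letter moving through the word one crossing at a time. The left face uses its
braidings to pull the i-th letter \<open>c\<close> to the front; each letter \<open>b\<close> that it overtakes becomes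
\<open>b \<lhd> c\<close>, while \<open>c\<close> itself is unchanged, and the character then erases it
(\<open>left_face_basis_append\<close>). The right face pushes the i-th letter to the back; now it is the moving
letter that gets acted upon, and all traces of the action are erased with it, so the rest of the
word is unchanged (\<open>right_face_basis_append\<close>). These two computations give the explicit formulas.

The relations between faces compare two ways of erasing the letters \<open>a\<close> and \<open>b\<close> from a word
\<open>u a v b w\<close>. They hold trivially when a right face is involved. For two left faces, \<open>v\<close> is acted upon
by \<open>b\<close> alone on both sides, whereas a letter \<open>y\<close> of \<open>u\<close> becomes \<open>(y \<lhd> b) \<lhd> (a \<lhd> b)\<close> on one side and
\<open>(y \<lhd> a) \<lhd> b\<close> on the other: this is self-distributivity, which is also what the braid relation
amounts to. The scalars from the characters contribute the same product to both sides.

Finally, any pre-bisimplicial structure gives a bicomplex by alternating sums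
(\<open>pre_bisimplicial_imp_bicomplex\<close>): in a composite of two such sums the relations match the terms
with \<open>i < j\<close> with the terms of the opposite composite with \<open>j \<le> i\<close>, with opposite signs.
So a composite of a sum with itself cancels, and the two mixed composites are negatives of each
other.
\<close>

section \<open>Linear extensions from a basis\<close>

lemma lookup_smult: "Poly_Mapping.lookup (smult c x) k = c * Poly_Mapping.lookup x k"
  unfolding smult_def by (simp add: map.rep_eq when_def)

lemma module_smult: "module (smult :: 'r::comm_ring_1 \<Rightarrow> ('b \<Rightarrow>\<^sub>0 'r) \<Rightarrow> _)"
  by unfold_locales
    (auto intro!: poly_mapping_eqI simp: lookup_smult lookup_add algebra_simps)

interpretation free_module: module smult
  by (rule module_smult)

lemma lin_ext_eq_sum_superset:
  assumes "finite A" "Poly_Mapping.keys x \<subseteq> A"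
  shows "lin_ext f x = (\<Sum>w\<in>A. smult (Poly_Mapping.lookup x w) (f w))"
  unfolding lin_ext_def
  by (rule sum.mono_neutral_left) (use assms in \<open>auto simp: in_keys_iff\<close>)

lemma module_hom_lin_ext:
  "module_hom smult smult (lin_ext (f :: 'b \<Rightarrow> ('c \<Rightarrow>\<^sub>0 'r::comm_ring_1)))"
proof (rule module_hom.intro[OF module_smult module_smult], unfold_locales)
  fix x y :: "'b \<Rightarrow>\<^sub>0 'r" and c :: 'r
  let ?A = "Poly_Mapping.keys x \<union> Poly_Mapping.keys y"
  have "lin_ext f (x + y) = (\<Sum>w\<in>?A. smult (Poly_Mapping.lookup (x + y) w) (f w))"
    by (rule lin_ext_eq_sum_superset) (use keys_add[of x y] in auto)
  also have "\<dots> = (\<Sum>w\<in>?A. smult (Poly_Mapping.lookup x w) (f w))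
      + (\<Sum>w\<in>?A. smult (Poly_Mapping.lookup y w) (f w))"
    by (simp add: lookup_add free_module.scale_left_distrib sum.distrib)
  also have "\<dots> = lin_ext f x + lin_ext f y"
    by (simp add: lin_ext_eq_sum_superset[of ?A])
  finally show "lin_ext f (x + y) = lin_ext f x + lin_ext f y" .
  have "lin_ext f (smult c x)
      = (\<Sum>w\<in>Poly_Mapping.keys x. smult (Poly_Mapping.lookup (smult c x) w) (f w))"
    by (rule lin_ext_eq_sum_superset) (auto simp: in_keys_iff lookup_smult)
  then show "lin_ext f (smult c x) = smult c (lin_ext f x)"
    by (simp add: lookup_smult lin_ext_def free_module.scale_sum_right)
qed

lemma lin_ext_basis [simp]: "lin_ext f (basis w) = f w"
  by (simp add: lin_ext_def basis_def)

lemma lin_ext_smult [simp]: "lin_ext f (smult c x) = smult c (lin_ext f x)"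
  by (rule module_hom.scale[OF module_hom_lin_ext])

lemma lin_ext_basis_eq_self: "lin_ext basis x = x"
proof (rule poly_mapping_eqI)
  fix k
  have "Poly_Mapping.lookup (lin_ext basis x) k
      = (\<Sum>w\<in>Poly_Mapping.keys x. if w = k then Poly_Mapping.lookup x w else 0)"
    unfolding lin_ext_def lookup_sum
    by (rule sum.cong) (simp_all add: lookup_smult basis_def lookup_single when_def)
  then show "Poly_Mapping.lookup (lin_ext basis x) k = Poly_Mapping.lookup x k"
    by (simp add: in_keys_iff)
qed

lemma module_hom_eq_lin_ext:
  assumes "module_hom smult smult F"
  shows "F x = lin_ext (\<lambda>w. F (basis w)) x"
proof -
  have "F x = F (lin_ext basis x)"
    by (simp add: lin_ext_basis_eq_self)
  also have "\<dots> = lin_ext (\<lambda>w. F (basis w)) x"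
    unfolding lin_ext_def
    by (simp add: module_hom.sum[OF assms] module_hom.scale[OF assms])
  finally show ?thesis .
qed

lemma subspace_tensor_power:
  "module.subspace smult (tensor_power S n :: ('a, 'b::comm_ring_1) tensors set)"
proof (rule free_module.subspaceI)
  fix x y :: "('a, 'b) tensors" and c :: 'b
  assume x: "x \<in> tensor_power S n"
  show "x + y \<in> tensor_power S n" if "y \<in> tensor_power S n"
    using x that keys_add[of x y] unfolding tensor_power_def by blast
  show "smult c x \<in> tensor_power S n"
    using x by (auto simp: tensor_power_def in_keys_iff lookup_smult)
qed (simp add: tensor_power_def)

lemma basis_in_tensor_power:
  "length w = n \<Longrightarrow> set w \<subseteq> S \<Longrightarrow> basis w \<in> tensor_power S n"
  by (simp add: tensor_power_def basis_def)

lemma smult_basis_in_tensor_power: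
  "length w = n \<Longrightarrow> set w \<subseteq> S \<Longrightarrow> smult c (basis w) \<in> tensor_power S n"
  by (intro free_module.subspace_scale[OF subspace_tensor_power] basis_in_tensor_power)

lemma linear_map_on_tensor_power:
  assumes F: "module_hom smult smult F"
    and "\<And>w. length w = n \<Longrightarrow> set w \<subseteq> S \<Longrightarrow> F (basis w) \<in> tensor_power S m"
  shows "linear_map_on smult (tensor_power S n) (tensor_power S m) F"
proof -
  have "F x \<in> tensor_power S m" if "x \<in> tensor_power S n" for x
  proof -
    have "F (basis w) \<in> tensor_power S m" if "w \<in> Poly_Mapping.keys x" for w
      using \<open>x \<in> tensor_power S n\<close> that by (intro assms(2)) (auto simp: tensor_power_def)
    then have "lin_ext (\<lambda>w. F (basis w)) x \<in> tensor_power S m"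
      unfolding lin_ext_def
      by (intro free_module.subspace_sum[OF subspace_tensor_power]
          free_module.subspace_scale[OF subspace_tensor_power])
    then show ?thesis
      by (subst module_hom_eq_lin_ext[OF F])
  qed
  then show ?thesis
    unfolding linear_map_on_def
    using module_hom.add[OF F] module_hom.scale[OF F] by blast
qed

lemma eq_on_tensor_power:
  assumes "module_hom smult smult F" "module_hom smult smult G"
    and "\<And>w. length w = n \<Longrightarrow> set w \<subseteq> S \<Longrightarrow> F (basis w) = G (basis w)"
    and "x \<in> tensor_power S n"
  shows "F x = G x"
proof -
  have "lin_ext (\<lambda>w. F (basis w)) x = lin_ext (\<lambda>w. G (basis w)) x"
    unfolding lin_ext_def
    by (rule sum.cong) (use assms(3,4) in \<open>auto simp: tensor_power_def\<close>)
  then show ?thesis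
    using assms(1,2) by (metis module_hom_eq_lin_ext)
qed

section \<open>Tensor products of maps on basis words\<close>

lemma tensor_map_basis:
  "length u = l \<Longrightarrow>
    tensor_map l \<phi> \<psi> (basis (u @ v)) = tensor (\<phi> (basis u)) (\<psi> (basis v))"
  by (simp add: tensor_map_def)

text \<open>A map that sends a basis word to a multiple of a basis word acts on a factor of a longer word
  by replacing that factor in place. The braiding and the characters both have this form, so no
  other tensors ever have to be computed.\<close>

lemma at_pos_basis:
  assumes "length u = i - 1" "length v = l" "\<phi> (basis v) = smult c (basis v')"
  shows "at_pos l \<phi> i (basis (u @ v @ w)) = smult c (basis (u @ v' @ w))"
proof -
  have "tensor (smult c (basis v')) (basis w) = smult c (basis (v' @ w))"
    by (simp add: tensor_def)
  then have "at_pos l \<phi> i (basis (u @ v @ w)) = tensor (basis u) (smult c (basis (v' @ w)))"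
    using assms by (simp add: at_pos_def tensor_map_basis)
  then show ?thesis
    by (simp add: tensor_def)
qed

lemma module_hom_at_pos: "module_hom smult smult (at_pos l \<phi> i)"
  unfolding at_pos_def tensor_map_def by (rule module_hom_lin_ext)

lemma comp_list_simps [simp]:
  "comp_list [] = id"
  "comp_list (f # fs) = f \<circ> comp_list fs"
  "comp_list (fs @ gs) = comp_list fs \<circ> comp_list gs"
  by (induction fs) (auto simp: comp_list_def)

lemma module_hom_comp_list:
  "(\<And>f. f \<in> set fs \<Longrightarrow> module_hom smult smult f) \<Longrightarrow> module_hom smult smult (comp_list fs)"
proof (induction fs)
  case Nil
  show ?case by (simp add: free_module.module_hom_ident)
next
  case (Cons f fs)
  then show ?case
    unfolding comp_list_simps by (intro module_hom_compose) auto
qed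

lemma module_hom_left_face: "module_hom smult smult (left_face \<sigma> \<epsilon> n i)"
  unfolding left_face_def
  by (rule module_hom_compose[OF module_hom_comp_list module_hom_at_pos])
    (auto intro: module_hom_at_pos)

lemma module_hom_right_face: "module_hom smult smult (right_face \<sigma> \<epsilon> n i)"
  unfolding right_face_def
  by (rule module_hom_compose[OF module_hom_comp_list module_hom_at_pos])
    (auto intro: module_hom_at_pos)

section \<open>Faces of basis words for a shelf\<close>

lemma shelf_braiding_at_pos:
  assumes "length u = i - 1"
  shows "at_pos 2 (shelf_braiding op) i (basis (u @ a # b # w)) = basis (u @ b # op a b # w)"
  using at_pos_basis[of u i "[a, b]" 2 "shelf_braiding op" 1 "[b, op a b]" w] assms
  by (simp add: shelf_braiding_def)

lemma const_form_at_pos: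
  assumes "length u = i - 1"
  shows "at_pos 1 (const_form c) i (basis (u @ a # w)) = smult c (basis (u @ w))"
  using at_pos_basis[of u i "[a]" 1 "const_form c" c "[]" w] assms
  by (simp add: const_form_def)

text \<open>The rightmost braiding of the composite is applied first and moves \<open>c\<close> past the last letter of
  \<open>u\<close>; that letter then belongs to the part of the word that later braidings do not touch. Hence
  the induction peels letters off the end of \<open>u\<close> while \<open>w\<close> grows.\<close>

lemma braiding_moves_to_front:
  "comp_list (map (at_pos 2 (shelf_braiding op)) [1..<Suc (length u)]) (basis (u @ c # w))
    = basis (c # map (\<lambda>b. op b c) u @ w)"
proof (induction u arbitrary: w rule: rev_induct)
  case Nil
  show ?case by simp
next
  case (snoc b u)
  have "[1..<Suc (length (u @ [b]))] = [1..<Suc (length u)] @ [Suc (length u)]"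
    by simp
  then show ?case
    using snoc.IH[of "op b c # w"] by (simp add: shelf_braiding_at_pos del: upt_Suc)
qed

text \<open>Here the moving letter is the one that changes: having passed \<open>w\<close>, it has been acted upon by
  all letters of \<open>w\<close> in turn.\<close>

lemma braiding_moves_to_back:
  "comp_list (map (at_pos 2 (shelf_braiding op)) (rev [Suc (length u)..<Suc (length u + length w)]))
      (basis (u @ c # w))
    = basis (u @ w @ [foldl op c w])"
proof (induction w arbitrary: u c)
  case Nil
  show ?case by simp
next
  case (Cons b w)
  have "[Suc (length u)..<Suc (length u + length (b # w))]
      = Suc (length u) # [Suc (length (u @ [b]))..<Suc (length (u @ [b]) + length w)]"
    by (simp add: upt_conv_Cons del: upt_Suc)
  then show ?case
    using Cons.IH[of "u @ [b]" "op c b"] by (simp add: shelf_braiding_at_pos del: upt_Suc)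
qed

lemma left_face_basis_append:
  assumes "i = Suc (length u)"
  shows "left_face (shelf_braiding op) (const_form r) n i (basis (u @ c # w))
    = smult r (basis (map (\<lambda>b. op b c) u @ w))"
  using const_form_at_pos[of "[]" 1 r c "map (\<lambda>b. op b c) u @ w"]
  by (simp only: left_face_def comp_apply assms braiding_moves_to_front) simp

lemma right_face_basis_append:
  assumes "i = Suc (length u)" "n = Suc (length u + length w)"
  shows "right_face (shelf_braiding op) (const_form r) n i (basis (u @ c # w))
    = smult r (basis (u @ w))"
  using const_form_at_pos[of "u @ w" n r "foldl op c w" "[]"]
  by (simp only: right_face_def comp_apply assms braiding_moves_to_back) simp

lemma list_split_at_position:
  assumes "1 \<le> i" "i \<le> length a"
  obtains u c w where "a = u @ c # w" "i = Suc (length u)"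
proof
  show "a = take (i - 1) a @ a ! (i - 1) # drop (Suc (i - 1)) a"
    by (rule id_take_nth_drop) (use assms in simp)
  show "i = Suc (length (take (i - 1) a))"
    using assms by simp
qed

lemma left_face_basis:
  assumes "1 \<le> i" "i \<le> length a"
  shows "left_face (shelf_braiding op) (const_form r) n i (basis a)
    = smult r (basis (map (\<lambda>b. op b (a ! (i - 1))) (take (i - 1) a) @ drop i a))"
proof -
  obtain u c w where "a = u @ c # w" "i = Suc (length u)"
    using list_split_at_position[OF assms] .
  then show ?thesis
    by (simp add: left_face_basis_append)
qed

lemma right_face_basis:
  assumes "1 \<le> i" "i \<le> length a"
  shows "right_face (shelf_braiding op) (const_form r) (length a) i (basis a)
    = smult r (basis (take (i - 1) a @ drop i a))"
proof -
  obtain u c w where "a = u @ c # w" "i = Suc (length u)"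
    using list_split_at_position[OF assms] .
  then show ?thesis
    by (simp add: right_face_basis_append)
qed

section \<open>The braiding, the characters and the pre-bisimplicial structure\<close>

lemma shelf_closed: "shelf S op \<Longrightarrow> a \<in> S \<Longrightarrow> b \<in> S \<Longrightarrow> op a b \<in> S"
  by (simp add: shelf_def)

lemma shelf_self_distributive:
  "shelf S op \<Longrightarrow> a \<in> S \<Longrightarrow> b \<in> S \<Longrightarrow> c \<in> S \<Longrightarrow> op (op a b) c = op (op a c) (op b c)"
  unfolding shelf_def by blast

lemma pre_braiding_shelf_braiding:
  assumes "shelf S op"
  shows "pre_braiding S (shelf_braiding op :: ('a, 'r::comm_ring_1) tensors \<Rightarrow> _)"
  unfolding pre_braiding_def
proof (intro conjI ballI)
  show "linear_map_on smult (tensor_power S 2) (tensor_power S 2) (shelf_braiding op)"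
  proof (rule linear_map_on_tensor_power)
    fix w assume "length w = 2" "set w \<subseteq> S"
    then obtain a b where "w = [a, b]" "a \<in> S" "b \<in> S"
      by (auto simp: length_Suc_conv numeral_2_eq_2)
    then show "shelf_braiding op (basis w) \<in> tensor_power S 2"
      using shelf_closed[OF assms] by (simp add: shelf_braiding_def basis_in_tensor_power)
  qed (simp add: shelf_braiding_def module_hom_lin_ext)
next
  fix x :: "('a, 'r) tensors" assume "x \<in> tensor_power S 3"
  let ?s = "at_pos 2 (shelf_braiding op) :: nat \<Rightarrow> ('a, 'r) tensors \<Rightarrow> _"
  show "(?s 1 \<circ> ?s 2 \<circ> ?s 1) x = (?s 2 \<circ> ?s 1 \<circ> ?s 2) x"
  proof (rule eq_on_tensor_power[OF _ _ _ \<open>x \<in> _\<close>])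
    fix w assume "length w = 3" "set w \<subseteq> S"
    then obtain a b c where w: "w = [a, b, c]" and S: "a \<in> S" "b \<in> S" "c \<in> S"
      by (auto simp: length_Suc_conv numeral_3_eq_3)
    have 1: "?s 1 (basis [x, y, z]) = basis [y, op x y, z]" for x y z
      using shelf_braiding_at_pos[of "[]" 1 op x y "[z]"] by simp
    have 2: "?s 2 (basis [x, y, z]) = basis [x, z, op y z]" for x y z
      using shelf_braiding_at_pos[of "[x]" 2 op y z "[]"] by simp
    have "op (op a b) c = op (op a c) (op b c)"
      using shelf_self_distributive[OF assms S] .
    then show "(?s 1 \<circ> ?s 2 \<circ> ?s 1) (basis w) = (?s 2 \<circ> ?s 1 \<circ> ?s 2) (basis w)"
      by (simp only: comp_apply w 1 2)
  qed (rule module_hom_compose module_hom_at_pos)+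
qed

text \<open>A form that takes the same value on all basis elements cannot tell words of equal length apart,
  and the braiding sends words to words.\<close>

lemma braided_character_const_form:
  "braided_character (S :: 'a set) (shelf_braiding op) (const_form (c :: 'r::comm_ring_1))"
  unfolding braided_character_def
proof (intro conjI ballI)
  show "linear_map_on smult (tensor_power S 1) (tensor_power S 0) (const_form c)"
  proof (rule linear_map_on_tensor_power)
    fix w assume "length w = 1" "set w \<subseteq> S"
    then show "const_form c (basis w) \<in> tensor_power S 0"
      by (auto simp: const_form_def length_Suc_conv intro!: smult_basis_in_tensor_power)
  qed (simp add: const_form_def module_hom_lin_ext)
next
  fix x :: "('a, 'r) tensors" assume "x \<in> tensor_power S 2"
  let ?e = "tensor_map 1 (const_form c) (const_form c)"
  have hom: "module_hom smult smult ?e" "module_hom smult smult (shelf_braiding op)"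
    by (simp_all add: tensor_map_def shelf_braiding_def module_hom_lin_ext)
  have e: "?e (basis [a, b]) = smult (c * c) (basis [])" for a b
    using tensor_map_basis[of "[a]" 1 "const_form c" "const_form c" "[b]"]
    by (simp add: const_form_def tensor_def)
  show "(?e \<circ> shelf_braiding op) x = ?e x"
  proof (rule eq_on_tensor_power[OF module_hom_compose[OF hom(2,1)] hom(1) _ \<open>x \<in> _\<close>])
    fix w assume "length w = 2" "set w \<subseteq> S"
    then obtain a b where "w = [a, b]"
      by (auto simp: length_Suc_conv numeral_2_eq_2)
    then show "(?e \<circ> shelf_braiding op) (basis w) = ?e (basis w)"
      by (simp add: shelf_braiding_def e del: One_nat_def)
  qed
qed

text \<open>Both sides of each relation are linear, so only words \<open>u a v b w\<close>, with \<open>a\<close> at position \<open>i\<close> and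
  \<open>b\<close> at position \<open>j\<close>, need to be compared. Erasing either letter leaves the other one in a word of
  length \<open>n - 1\<close>, at position \<open>j - 1\<close> if \<open>a\<close> went first and at position \<open>i\<close> if \<open>b\<close> did.\<close>

lemma pre_bisimplicial_shelf:
  assumes "shelf S op"
  shows "pre_bisimplicial smult (tensor_power S)
    (left_face (shelf_braiding op) (const_form (r :: 'r::comm_ring_1)))
    (right_face (shelf_braiding op) (const_form s))"
    (is "pre_bisimplicial _ _ ?f ?g")
  unfolding pre_bisimplicial_def
proof (intro conjI allI impI ballI module_smult subspace_tensor_power)
  fix n i :: nat assume i: "1 \<le> i \<and> i \<le> n"
  note [simp] = shelf_closed[OF assms]
  show "linear_map_on smult (tensor_power S n) (tensor_power S (n - 1)) (?f n i)"
  proof (rule linear_map_on_tensor_power[OF module_hom_left_face])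
    fix z assume z: "length z = n" "set z \<subseteq> S"
    obtain u c w where "z = u @ c # w" "i = Suc (length u)"
      using list_split_at_position[of i z] i z by auto
    then show "?f n i (basis z) \<in> tensor_power S (n - 1)"
      using z by (auto simp: left_face_basis_append subset_iff intro!: smult_basis_in_tensor_power)
  qed
  show "linear_map_on smult (tensor_power S n) (tensor_power S (n - 1)) (?g n i)"
  proof (rule linear_map_on_tensor_power[OF module_hom_right_face])
    fix z assume z: "length z = n" "set z \<subseteq> S"
    obtain u c w where "z = u @ c # w" "i = Suc (length u)"
      using list_split_at_position[of i z] i z by auto
    then show "?g n i (basis z) \<in> tensor_power S (n - 1)"
      using z by (auto simp: right_face_basis_append subset_iff intro!: smult_basis_in_tensor_power)
  qed
next
  fix n i j :: nat and x :: "('a, 'r) tensors"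
  assume ij: "1 \<le> i \<and> i < j \<and> j \<le> n" and x: "x \<in> tensor_power S n"
  have words: "?f (n - 1) i (?f n j (basis z)) = ?f (n - 1) (j - 1) (?f n i (basis z)) \<and>
      ?g (n - 1) i (?g n j (basis z)) = ?g (n - 1) (j - 1) (?g n i (basis z)) \<and>
      ?f (n - 1) i (?g n j (basis z)) = ?g (n - 1) (j - 1) (?f n i (basis z)) \<and>
      ?g (n - 1) i (?f n j (basis z)) = ?f (n - 1) (j - 1) (?g n i (basis z))"
    if z: "length z = n" "set z \<subseteq> S" for z
  proof -
    obtain y b w where y: "z = y @ b # w" "j = Suc (length y)"
      using list_split_at_position[of j z] ij z(1) by auto
    obtain u a v where u: "y = u @ a # v" "i = Suc (length u)"
      using list_split_at_position[of i y] ij y(2) by auto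
    have z_eq: "z = u @ a # v @ b # w" and i: "i = Suc (length u)"
      and j: "j = Suc (Suc (length u + length v))"
      and n: "n = Suc (Suc (length u + length v + length w))"
      using y u z(1) by simp_all
    \<comment> \<open>The only place where the letters of both sides differ: two left faces, on the part \<open>u\<close>.\<close>
    have distr: "map (\<lambda>y. op (op y b) (op a b)) u = map (\<lambda>y. op (op y a) b) u"
    proof (rule map_cong[OF refl])
      fix y assume "y \<in> set u"
      then have "y \<in> S" "a \<in> S" "b \<in> S"
        using z(2) by (auto simp: z_eq)
      then show "op (op y b) (op a b) = op (op y a) b"
        by (rule shelf_self_distributive[OF assms, symmetric])
    qed
    have fi: "?f n i (basis z) = smult r (basis ((map (\<lambda>y. op y a) u @ v) @ b # w))"
      using left_face_basis_append[of i u op r n a "v @ b # w"] i by (simp add: z_eq)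
    have gi: "?g n i (basis z) = smult s (basis ((u @ v) @ b # w))"
      using right_face_basis_append[of i u n "v @ b # w" op s a] i n by (simp add: z_eq)
    have fj: "?f n j (basis z)
        = smult r (basis (map (\<lambda>y. op y b) u @ op a b # map (\<lambda>y. op y b) v @ w))"
      using left_face_basis_append[of j "u @ a # v" op r n b w] j by (simp add: z_eq)
    have gj: "?g n j (basis z) = smult s (basis (u @ a # v @ w))"
      using right_face_basis_append[of j "u @ a # v" n w op s b] j n by (simp add: z_eq)
    \<comment> \<open>Positions and lengths in the eight words to which the second face is applied.\<close>
    have i': "i = Suc (length (map (\<lambda>y. op y b) u))"
      and j': "j - 1 = Suc (length (u @ v))" "j - 1 = Suc (length (map (\<lambda>y. op y a) u @ v))"
      and n': "n - 1 = Suc (length u + length (v @ w))"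
        "n - 1 = Suc (length (map (\<lambda>y. op y b) u) + length (map (\<lambda>y. op y b) v @ w))"
        "n - 1 = Suc (length (u @ v) + length w)"
        "n - 1 = Suc (length (map (\<lambda>y. op y a) u @ v) + length w)"
      using i j n by simp_all
    note second_face =
      left_face_basis_append[OF i] left_face_basis_append[OF i']
      left_face_basis_append[OF j'(1)] left_face_basis_append[OF j'(2)]
      right_face_basis_append[OF i n'(1)] right_face_basis_append[OF i' n'(2)]
      right_face_basis_append[OF j'(1) n'(3)] right_face_basis_append[OF j'(2) n'(4)]
    show ?thesis
      unfolding fi gi fj gj module_hom.scale[OF module_hom_left_face]
        module_hom.scale[OF module_hom_right_face] second_face
      by (simp add: comp_def distr mult.commute)
  qed
  note hom = module_hom_compose[OF module_hom_left_face module_hom_left_face, unfolded comp_def]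
    module_hom_compose[OF module_hom_right_face module_hom_right_face, unfolded comp_def]
    module_hom_compose[OF module_hom_left_face module_hom_right_face, unfolded comp_def]
    module_hom_compose[OF module_hom_right_face module_hom_left_face, unfolded comp_def]
  show "?f (n - 1) i (?f n j x) = ?f (n - 1) (j - 1) (?f n i x)"
    by (rule eq_on_tensor_power[OF hom(1) hom(1) _ x]) (use words in blast)
  show "?g (n - 1) i (?g n j x) = ?g (n - 1) (j - 1) (?g n i x)"
    by (rule eq_on_tensor_power[OF hom(2) hom(2) _ x]) (use words in blast)
  show "?f (n - 1) i (?g n j x) = ?g (n - 1) (j - 1) (?f n i x)"
    by (rule eq_on_tensor_power[OF hom(4) hom(3) _ x]) (use words in blast)
  show "?g (n - 1) i (?f n j x) = ?f (n - 1) (j - 1) (?g n i x)"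
    by (rule eq_on_tensor_power[OF hom(3) hom(4) _ x]) (use words in blast)
qed

section \<open>From pre-bisimplicial structures to bicomplexes\<close>

text \<open>The substitution \<open>(i, j) \<mapsto> (j - 1, i)\<close> maps the triangle \<open>i < j\<close> bijectively onto the triangle
  \<open>j \<le> i\<close>, and lowering one index by 1 flips the sign.\<close>

lemma alternating_half_sums_cancel:
  fixes A B :: "nat \<Rightarrow> nat \<Rightarrow> 'm::ab_group_add"
    and scale :: "'r::comm_ring_1 \<Rightarrow> 'm \<Rightarrow> 'm"
  assumes "module scale"
    and AB: "\<And>i j. 1 \<le> i \<Longrightarrow> i < j \<Longrightarrow> j \<le> n \<Longrightarrow> A i j = B (j - 1) i"
  shows "(\<Sum>(i, j) \<in> {(i, j). 1 \<le> i \<and> i < j \<and> j \<le> n}.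
          scale ((-1) ^ (i - 1) * (-1) ^ (j - 1)) (A i j))
    = - (\<Sum>(i, j) \<in> {(i, j). 1 \<le> j \<and> j \<le> i \<and> i \<le> n - 1}.
          scale ((-1) ^ (i - 1) * (-1) ^ (j - 1)) (B i j))"
proof -
  interpret module scale by fact
  show ?thesis
    unfolding sum_negf[symmetric]
  proof (rule sum.reindex_bij_witness[where i = "\<lambda>(i, j). (j, Suc i)" and j = "\<lambda>(i, j). (j - 1, i)"];
      clarsimp)
    fix i j :: nat assume ij: "Suc 0 \<le> i" "i < j" "j \<le> n"
    \<comment> \<open>As \<open>j\<close> is at least 2, the truncated subtraction in the exponents is exact.\<close>
    then obtain k where "j = Suc (Suc k)"
      by (cases j; cases "j - 1") auto
    with AB[of i j] ij
    show "- scale ((-1) ^ (j - Suc (Suc 0)) * (-1) ^ (i - Suc 0)) (B (j - Suc 0) i)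
        = scale ((-1) ^ (i - Suc 0) * (-1) ^ (j - Suc 0)) (A i j)"
      by (simp add: mult.commute)
  qed auto
qed

lemma linear_map_on_sum:
  assumes "module scale" "module.subspace scale U" "linear_map_on scale U W f"
    and "\<And>i. i \<in> I \<Longrightarrow> x i \<in> U"
  shows "f (\<Sum>i\<in>I. scale (c i) (x i)) = (\<Sum>i\<in>I. scale (c i) (f (x i)))"
proof -
  interpret module scale by fact
  have f_add: "f (y + z) = f y + f z" if "y \<in> U" "z \<in> U" for y z
    using assms(3) that by (simp add: linear_map_on_def)
  have f_scale: "f (scale r y) = scale r (f y)" if "y \<in> U" for y r
    using assms(3) that by (simp add: linear_map_on_def)
  have "f 0 = 0"
    using f_scale[of 0 0] subspace_0[OF assms(2)] by simp
  with assms(4) show ?thesis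
    by (induction I rule: infinite_finite_induct)
      (simp_all add: f_add f_scale subspace_scale[OF assms(2)] subspace_sum[OF assms(2)])
qed

lemma linear_map_on_linear_combination:
  assumes "module scale" "module.subspace scale W"
    and f: "\<And>i. i \<in> I \<Longrightarrow> linear_map_on scale U W (f i)"
  shows "linear_map_on scale U W (\<lambda>x. \<Sum>i\<in>I. scale (c i) (f i x))"
proof -
  interpret module scale by fact
  show ?thesis
    unfolding linear_map_on_def
  proof (intro conjI ballI allI)
    fix x assume x: "x \<in> U"
    show "(\<Sum>i\<in>I. scale (c i) (f i x)) \<in> W"
      by (intro subspace_sum subspace_scale assms(2))
        (use f x in \<open>auto simp: linear_map_on_def\<close>)
    show "(\<Sum>i\<in>I. scale (c i) (f i (scale r x))) = scale r (\<Sum>i\<in>I. scale (c i) (f i x))" for r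
      unfolding scale_sum_right
      by (rule sum.cong) (use f x in \<open>auto simp: linear_map_on_def mult.commute\<close>)
    show "(\<Sum>i\<in>I. scale (c i) (f i (x + y)))
        = (\<Sum>i\<in>I. scale (c i) (f i x)) + (\<Sum>i\<in>I. scale (c i) (f i y))" if "y \<in> U" for y
      unfolding sum.distrib[symmetric]
      by (rule sum.cong) (use f x that in \<open>auto simp: linear_map_on_def scale_right_distrib\<close>)
  qed
qed

text \<open>Here \<open>y\<close> and \<open>z\<close> are the images of one element under two families of faces, to which \<open>f\<close> and \<open>g\<close>
  are then applied. The right-hand side is antisymmetric in the two families, which yields
  both consequences needed for a bicomplex: it vanishes if the families coincide, in any
  characteristic, and it changes sign if they are exchanged.\<close>

lemma composite_of_alternating_sums:
  fixes scale :: "'r::comm_ring_1 \<Rightarrow> 'm::ab_group_add \<Rightarrow> 'm"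
  assumes mod: "module scale" "module.subspace scale U"
    and f: "\<And>i. 1 \<le> i \<Longrightarrow> i \<le> n - 1 \<Longrightarrow> linear_map_on scale U W (f i)"
    and y: "\<And>j. 1 \<le> j \<Longrightarrow> j \<le> n \<Longrightarrow> y j \<in> U"
    and swap: "\<And>i j. 1 \<le> i \<Longrightarrow> i < j \<Longrightarrow> j \<le> n \<Longrightarrow> f i (y j) = g (j - 1) (z i)"
  shows "(\<Sum>i=1..n - 1. scale ((-1) ^ (i - 1)) (f i (\<Sum>j=1..n. scale ((-1) ^ (j - 1)) (y j))))
    = (\<Sum>(i, j) \<in> {(i, j). 1 \<le> j \<and> j \<le> i \<and> i \<le> n - 1}.
        scale ((-1) ^ (i - 1) * (-1) ^ (j - 1)) (f i (y j)))
    - (\<Sum>(i, j) \<in> {(i, j). 1 \<le> j \<and> j \<le> i \<and> i \<le> n - 1}.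
        scale ((-1) ^ (i - 1) * (-1) ^ (j - 1)) (g i (z j)))"
    (is "?L = sum ?t ?D - sum ?t' ?D")
proof -
  interpret module scale by fact
  let ?U = "{(i, j). 1 \<le> i \<and> i < j \<and> j \<le> n}"
  have fin: "finite ({1..n - 1} \<times> {1..n})" by simp
  have "?L = (\<Sum>i=1..n - 1. \<Sum>j=1..n. ?t (i, j))"
  proof (rule sum.cong[OF refl])
    fix i assume "i \<in> {1..n - 1}"
    then have "linear_map_on scale U W (f i)"
      by (auto intro: f)
    then have "f i (\<Sum>j=1..n. scale ((-1) ^ (j - 1)) (y j))
        = (\<Sum>j=1..n. scale ((-1) ^ (j - 1)) (f i (y j)))"
      by (rule linear_map_on_sum[OF mod]) (auto intro: y)
    then show "scale ((-1) ^ (i - 1)) (f i (\<Sum>j=1..n. scale ((-1) ^ (j - 1)) (y j)))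
        = (\<Sum>j=1..n. ?t (i, j))"
      by (simp add: scale_sum_right)
  qed
  also have "\<dots> = sum ?t ({1..n - 1} \<times> {1..n})"
    by (simp add: sum.cartesian_product)
  also have "{1..n - 1} \<times> {1..n} = ?U \<union> ?D"
    by auto
  also have "sum ?t (?U \<union> ?D) = sum ?t ?U + sum ?t ?D"
    by (rule sum.union_disjoint) (auto intro: finite_subset[OF _ fin])
  also have "sum ?t ?U = - sum ?t' ?D"
    by (rule alternating_half_sums_cancel[OF mod(1)]) (rule swap)
  finally show ?thesis
    by simp
qed

lemma pre_bisimplicial_imp_bicomplex:
  fixes scale :: "'r::comm_ring_1 \<Rightarrow> 'm::ab_group_add \<Rightarrow> 'm"
  assumes pre: "pre_bisimplicial scale V f g"
  shows "bicomplex scale V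
    (\<lambda>n x. \<Sum>i=1..n. scale ((-1) ^ (i - 1)) (f n i x))
    (\<lambda>n x. \<Sum>i=1..n. scale ((-1) ^ (i - 1)) (g n i x))"
proof -
  from pre have mod: "module scale" and V: "module.subspace scale (V n)" for n
    by (auto simp: pre_bisimplicial_def)
  interpret module scale by fact
  have f: "linear_map_on scale (V n) (V (n - 1)) (f n i)"
    and g: "linear_map_on scale (V n) (V (n - 1)) (g n i)" if "1 \<le> i" "i \<le> n" for n i
    using pre that by (auto simp: pre_bisimplicial_def)
  have rel: "f (n - 1) i (f n j x) = f (n - 1) (j - 1) (f n i x)"
      "g (n - 1) i (g n j x) = g (n - 1) (j - 1) (g n i x)"
      "f (n - 1) i (g n j x) = g (n - 1) (j - 1) (f n i x)"
      "g (n - 1) i (f n j x) = f (n - 1) (j - 1) (g n i x)"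
    if "x \<in> V n" "1 \<le> i" "i < j" "j \<le> n" for n i j x
    using pre that unfolding pre_bisimplicial_def by blast+
  have mem: "f n j x \<in> V (n - 1)" "g n j x \<in> V (n - 1)"
    if "x \<in> V n" "1 \<le> j" "j \<le> n" for n j x
    using f g that by (auto simp: linear_map_on_def)
  note half = alternating_half_sums_cancel[OF mod]
  show ?thesis
    unfolding bicomplex_def
  proof (intro conjI allI ballI mod V linear_map_on_linear_combination)
    fix n x assume x: "x \<in> V n"
    let ?D = "\<lambda>F G :: nat \<Rightarrow> nat \<Rightarrow> 'm \<Rightarrow> 'm.
      \<Sum>(i, j) \<in> {(i, j). 1 \<le> j \<and> j \<le> i \<and> i \<le> n - 1}.
        scale ((-1) ^ (i - 1) * (-1) ^ (j - 1)) (F (n - 1) i (G n j x))"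
    have composite: "(\<Sum>i=1..n - 1. scale ((-1) ^ (i - 1))
        (F (n - 1) i (\<Sum>i=1..n. scale ((-1) ^ (i - 1)) (G n i x)))) = ?D F G - ?D G F"
      if F: "\<And>i. 1 \<le> i \<Longrightarrow> i \<le> n - 1 \<Longrightarrow>
          linear_map_on scale (V (n - 1)) (V (n - 1 - 1)) (F (n - 1) i)"
        and G: "\<And>j. 1 \<le> j \<Longrightarrow> j \<le> n \<Longrightarrow> G n j x \<in> V (n - 1)"
        and rel: "\<And>i j. 1 \<le> i \<Longrightarrow> i < j \<Longrightarrow> j \<le> n \<Longrightarrow>
          F (n - 1) i (G n j x) = G (n - 1) (j - 1) (F n i x)" for F G
      by (rule composite_of_alternating_sums[OF mod V]) (fact F G rel)+
    show "(\<Sum>i=1..n - 1. scale ((-1) ^ (i - 1))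
        (f (n - 1) i (\<Sum>i=1..n. scale ((-1) ^ (i - 1)) (f n i x)))) = 0"
      using composite[of f f, OF f mem(1)[OF x] rel(1)[OF x]] by simp
    show "(\<Sum>i=1..n - 1. scale ((-1) ^ (i - 1))
        (g (n - 1) i (\<Sum>i=1..n. scale ((-1) ^ (i - 1)) (g n i x)))) = 0"
      using composite[of g g, OF g mem(2)[OF x] rel(2)[OF x]] by simp
    show "(\<Sum>i=1..n - 1. scale ((-1) ^ (i - 1))
        (f (n - 1) i (\<Sum>i=1..n. scale ((-1) ^ (i - 1)) (g n i x))))
      = - (\<Sum>i=1..n - 1. scale ((-1) ^ (i - 1))
        (g (n - 1) i (\<Sum>i=1..n. scale ((-1) ^ (i - 1)) (f n i x))))"
    proof -
      note composite[of f g, OF f mem(2)[OF x] rel(3)[OF x]]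
      moreover note composite[of g f, OF g mem(1)[OF x] rel(4)[OF x]]
      ultimately show ?thesis by simp
    qed
  qed (use f g in auto)
qed

theorem proposition4p18:
  fixes S :: "'a set" and op :: "'a \<Rightarrow> 'a \<Rightarrow> 'a" (infixl "\<lhd>" 70)
    and \<sigma> \<epsilon> \<epsilon>T :: "('a, laurent) tensors \<Rightarrow> ('a, laurent) tensors"
  assumes "shelf S (\<lhd>)"
    and "\<sigma> = shelf_braiding (\<lhd>)"
    and "\<epsilon> = const_form 1"
    and "\<epsilon>T = const_form laurent_T"
  shows "pre_braiding S \<sigma> \<and> braided_character S \<sigma> \<epsilon> \<and> braided_character S \<sigma> \<epsilon>T \<and>
    bicomplex smult (tensor_power S) (left_differential \<sigma> \<epsilon>) (right_differential \<sigma> \<epsilon>T) \<and>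
    (\<forall>n a. length a = n \<and> set a \<subseteq> S \<longrightarrow>
       left_differential \<sigma> \<epsilon> n (basis a) =
         (\<Sum>i=1..n. smult ((-1) ^ (i - 1))
            (basis (map (\<lambda>b. b \<lhd> a ! (i - 1)) (take (i - 1) a) @ drop i a))) \<and>
       right_differential \<sigma> \<epsilon>T n (basis a) =
         (\<Sum>i=1..n. smult ((-1) ^ (i - 1) * laurent_T) (basis (take (i - 1) a @ drop i a)))) \<and>
    refined_by smult (tensor_power S)
      (left_differential \<sigma> \<epsilon>) (right_differential \<sigma> \<epsilon>T)
      (left_face \<sigma> \<epsilon>) (right_face \<sigma> \<epsilon>T)"
proof -
  have pre: "pre_bisimplicial smult (tensor_power S) (left_face \<sigma> \<epsilon>) (right_face \<sigma> \<epsilon>T)"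
    unfolding assms(2-4) by (rule pre_bisimplicial_shelf[OF assms(1)])
  have "bicomplex smult (tensor_power S) (left_differential \<sigma> \<epsilon>) (right_differential \<sigma> \<epsilon>T)"
    using pre_bisimplicial_imp_bicomplex[OF pre]
    by (simp add: left_differential_def[abs_def] right_differential_def[abs_def])
  moreover have "refined_by smult (tensor_power S)
      (left_differential \<sigma> \<epsilon>) (right_differential \<sigma> \<epsilon>T)
      (left_face \<sigma> \<epsilon>) (right_face \<sigma> \<epsilon>T)"
    by (simp add: refined_by_def pre left_differential_def right_differential_def)
  moreover have "left_differential \<sigma> \<epsilon> (length a) (basis a) =
         (\<Sum>i=1..length a. smult ((-1) ^ (i - 1))
            (basis (map (\<lambda>b. b \<lhd> a ! (i - 1)) (take (i - 1) a) @ drop i a)))" for a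
    unfolding left_differential_def assms(2-4)
    by (rule sum.cong) (simp_all add: left_face_basis)
  moreover have "right_differential \<sigma> \<epsilon>T (length a) (basis a) =
         (\<Sum>i=1..length a. smult ((-1) ^ (i - 1) * laurent_T)
            (basis (take (i - 1) a @ drop i a)))" for a
    unfolding right_differential_def assms(2-4)
    by (rule sum.cong) (simp_all add: right_face_basis)
  ultimately show ?thesis
    unfolding assms(2-4)
    by (auto intro: pre_braiding_shelf_braiding[OF assms(1)] braided_character_const_form)
qed

end
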